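(* Let $I$ be a Tamari interval of size $n$. Then its Tamari distance is given by $$\mathrm{d}(I)=\sum_{0\le i<j\le n}(c_i(I)-1)(1-d_{n-j}(I)),$$ where $(c_0(I),\dots,c_n(I))$ and $(d_0(I),\dots,d_n(I))$ are the contact and descent vectors of $I$.
   Context: A Dyck path of size $n$ is a word with $n$ letters $u=(1,1)$ and $n$ letters $d=(1,-1)$, seen as a walk from $(0,0)$ staying weakly above the $x$-axis. A contact is a point of the path on the $x$-axis. The Tamari order $\preceq$ on Dyck paths of size $n$ is the reflexive transitive closure of: $VdP_1W$ is covered by $VP_1dW$, where $V,W$ are words and $P_1$ is a non-empty Dyck path returning to the $x$-axis only at its end. The contact vector of $P$ is $(c_0(P),\dots,c_n(P))$ where $c_0(P)$ is the number of non-initial contacts of $P$ and $c_k(P)$, $k\ge1$, is the number of non-initial contacts of the (maximal) Dyck path following the $k$-th up step of $P$. The descent vector of $P$ is $(d_0(P),\dots,d_n(P))$, the nonnegative integers with $P=d^{d_n(P)}u\,d^{d_{n-1}(P)}u\cdots u\,d^{d_0(P)}$. A Tamari interval of size $n\ge0$ is a pair $I=[P,Q]$ of Dyck paths of size $n$ with $P\preceq Q$; $c_k(I)=c_k(P)$ and $d_k(I)=d_k(Q)$. Its Tamari distance $\mathrm{d}(I)$ is the length of the longest strictly increasing chain from $P$ to $Q$, i.e. the largest $k$ such that there exist Dyck paths $P=D_0\prec D_1\prec\dots\prec D_k=Q$. *)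

theory Defs
  imports Main
begin

datatype step = Up | Down

definition height :: "step list \<Rightarrow> int" where
  "height w = int (count_list w Up) - int (count_list w Down)"

definition dyck :: "step list \<Rightarrow> bool" where
  "dyck w \<longleftrightarrow> (\<forall>i\<le>length w. height (take i w) \<ge> 0) \<and> height w = 0"

definition dyck_path :: "nat \<Rightarrow> step list \<Rightarrow> bool" where
  "dyck_path n w \<longleftrightarrow> dyck w \<and> count_list w Up = n"

definition noninitial_contacts :: "step list \<Rightarrow> nat" where
  "noninitial_contacts w = card {i. 0 < i \<and> i \<le> length w \<and> height (take i w) = 0}"

definition prime_dyck :: "step list \<Rightarrow> bool" where
  "prime_dyck w \<longleftrightarrow> dyck w \<and> w \<noteq> [] \<and>
     (\<forall>i. 0 < i \<and> i < length w \<longrightarrow> height (take i w) \<noteq> 0)"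

definition tamari_cover :: "nat \<Rightarrow> step list \<Rightarrow> step list \<Rightarrow> bool" where
  "tamari_cover n P Q \<longleftrightarrow> dyck_path n P \<and> dyck_path n Q \<and>
     (\<exists>V P1 W. prime_dyck P1 \<and> P = V @ [Down] @ P1 @ W \<and> Q = V @ P1 @ [Down] @ W)"

definition tamari_le :: "nat \<Rightarrow> step list \<Rightarrow> step list \<Rightarrow> bool" where
  "tamari_le n P Q \<longleftrightarrow> dyck_path n P \<and> dyck_path n Q \<and> (tamari_cover n)\<^sup>*\<^sup>* P Q"

definition tamari_less :: "nat \<Rightarrow> step list \<Rightarrow> step list \<Rightarrow> bool" where
  "tamari_less n P Q \<longleftrightarrow> tamari_le n P Q \<and> P \<noteq> Q"

text \<open>The suffix of a word following its k-th up step, for k at most the number of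
  up steps (the whole word for k = 0).\<close>
fun after_up :: "nat \<Rightarrow> step list \<Rightarrow> step list" where
  "after_up 0 w = w"
| "after_up (Suc k) w = after_up k (tl (dropWhile (\<lambda>s. s = Down) w))"

definition maximal_dyck_prefix :: "step list \<Rightarrow> step list" where
  "maximal_dyck_prefix w = take (GREATEST m. m \<le> length w \<and> dyck (take m w)) w"

definition path_contact :: "step list \<Rightarrow> nat \<Rightarrow> nat" where
  "path_contact P k =
     (if k = 0 then noninitial_contacts P
      else noninitial_contacts (maximal_dyck_prefix (after_up k P)))"

text \<open>For ds = [d0, ..., dn], the word with dn down steps, then an up step, then
  d(n-1) down steps, and so on, ending with d0 down steps.\<close>
definition word_of_descents :: "nat list \<Rightarrow> step list" where
  "word_of_descents ds =
     replicate (last ds) Down @ concat (map (\<lambda>d. Up # replicate d Down) (rev (butlast ds)))"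

text \<open>Every word has exactly one such decomposition, so the description is proper. Entry k of the
  list is the number of down steps d_k; entry 0 counts the final descent.\<close>
definition descent_vector :: "step list \<Rightarrow> nat list" where
  "descent_vector P =
     (THE ds. length ds = Suc (count_list P Up) \<and> P = word_of_descents ds)"

definition path_descent :: "step list \<Rightarrow> nat \<Rightarrow> nat" where
  "path_descent P k = descent_vector P ! k"

definition tamari_interval :: "nat \<Rightarrow> step list \<times> step list \<Rightarrow> bool" where
  "tamari_interval n I \<longleftrightarrow> tamari_le n (fst I) (snd I)"

definition contact :: "step list \<times> step list \<Rightarrow> nat \<Rightarrow> nat" where
  "contact I k = path_contact (fst I) k"

definition descent :: "step list \<times> step list \<Rightarrow> nat \<Rightarrow> nat" where
  "descent I k = path_descent (snd I) k"

text \<open>For a Tamari interval the set is non-empty and finite: the order is antisymmetric and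
  there are finitely many Dyck paths of size n, so Max is attained.\<close>
definition tamari_distance :: "nat \<Rightarrow> step list \<times> step list \<Rightarrow> nat" where
  "tamari_distance n I = Max {k. \<exists>C :: nat \<Rightarrow> step list.
     C 0 = fst I \<and> C k = snd I \<and> (\<forall>i<k. tamari_less n (C i) (C (Suc i)))}"

end

theory Submission
  imports Defs
begin

text \<open>Cutting a Dyck path at its last return to the axis, as \<open>L u R d\<close>, turns it into a binary tree
  with left subtree \<open>L\<close> and right subtree \<open>R\<close>. The \<open>k\<close>-th up step becomes the \<open>k\<close>-th node in
  in-order, and a Tamari cover becomes a rotation \<open>((A, B), C) \<rightarrow> (A, (B, C))\<close>. Two integer vectors
  describe such a tree. The sizes of the right subtrees, listed in in-order (\<open>right_sizes\<close>),
  determine the tree, and a rotation enlarges exactly one of them. The left depths of the leaves,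
  listed from left to right (\<open>left_depths\<close>), drop by one under a rotation on the leaves of \<open>A\<close> and do
  not change elsewhere.

  For a pair of trees \<open>p, q\<close> let \<open>\<delta>(p, q)\<close> be the sum, over all in-order indices \<open>k\<close>, of the left
  depth in \<open>p\<close> of the leaf \<open>k\<close> minus that of the leaf \<open>k + r\<close>, where \<open>r\<close> is the size of the right
  subtree of node \<open>k\<close> in \<open>q\<close> (\<open>rotation_distance\<close>). Call a node together with its right subtree a
  block. If no right subtree of \<open>p\<close> is larger than that of the same node in \<open>q\<close>, then the summand of
  \<open>k\<close> is the number of consecutive blocks of \<open>p\<close> that make up the part of the right subtree of \<open>k\<close>
  in \<open>q\<close> beyond the one in \<open>p\<close>. If \<open>p\<close> is rotated to \<open>p'\<close> and the right subtrees of \<open>p'\<close> are still no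
  larger than those of \<open>q\<close>, then \<open>\<delta>(p, q) - \<delta>(p', q)\<close> is the number of nodes in an explicit set that
  contains the rotated node (\<open>rotation_distance_step\<close>). Hence every step of a chain from \<open>p\<close> to \<open>q\<close>
  costs at least one, and as \<open>\<delta>(q, q) = 0\<close> no chain is longer than \<open>\<delta>(p, q)\<close>. Conversely, at the first
  node whose right subtree is too small a rotation is possible, it does not overshoot \<open>q\<close>, and it
  costs exactly one (\<open>unit_rotation_exists\<close>); iterating this gives a chain of length \<open>\<delta>(p, q)\<close>
  (\<open>rotation_chain\<close>). So \<open>\<delta>\<close> is the Tamari distance (\<open>tamari_distance_word\<close>).

  It remains to read \<open>\<delta>\<close> off the contact and descent vectors. The numbers \<open>c\<^sub>i(P) - 1\<close> are the steps
  of a Lukasiewicz path: for \<open>j \<ge> 1\<close> their sum over \<open>i < j\<close> is one less than the left depth of the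
  \<open>j\<close>-th leaf (\<open>sum_contacts\<close>). The down step of \<open>Q\<close> that matches the \<open>k\<close>-th up step comes after the
  last up step of the block of node \<open>k\<close>, so weighting the indices \<open>j\<close> by \<open>d\<^bsub>n-j\<^esub>(Q)\<close> amounts to
  visiting the ends of all blocks of \<open>Q\<close> (\<open>down_sum_word\<close>).\<close>

section \<open>Dyck paths as binary trees\<close>

datatype btree = Leaf | Node btree btree

fun word :: "btree \<Rightarrow> step list" where
  "word Leaf = []"
| "word (Node l r) = word l @ Up # word r @ [Down]"

lemma height_simps [simp]:
  "height [] = 0"
  "height (Up # w) = height w + 1"
  "height (Down # w) = height w - 1"
  "height (v @ w) = height v + height w"
  by (auto simp: height_def)

lemma count_Up_word [simp]: "count_list (word t) Up = size t"
  by (induction t) auto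

lemma height_word [simp]: "height (word t) = 0"
  by (induction t) auto

lemma height_take_word_nonneg: "height (take i (word t)) \<ge> 0"
proof (induction t arbitrary: i)
  case (Node l r)
  show ?case
  proof (cases "i - length (word l)")
    case 0
    then show ?thesis using Node(1)[of i] by simp
  next
    case (Suc j)
    have "height (take (j - length (word r)) [Down]) \<ge> -1"
      by (cases "j - length (word r)") auto
    then show ?thesis using Suc Node(1)[of i] Node(2)[of j] by simp
  qed
qed simp

lemma dyck_word: "dyck (word t)"
  by (simp add: dyck_def height_take_word_nonneg)

text \<open>Words are parsed by a shift-reduce automaton whose stack holds the trees of the Dyck factors
  between consecutive unmatched up steps, topmost first. Working with a stack gives access to a
  cover in the middle of a word: a prefix of the word is parsed before its suffix is known. The
  last equation is a default for words that go below the axis.\<close>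
fun shift :: "step \<Rightarrow> btree list \<Rightarrow> btree list" where
  "shift Up st = Leaf # st"
| "shift Down (x # y # st) = Node y x # st"
| "shift Down st = st"

fun stack_word :: "btree list \<Rightarrow> step list" where
  "stack_word [] = []"
| "stack_word [t] = word t"
| "stack_word (t # s # st) = stack_word (s # st) @ Up # word t"

lemma fold_shift_word: "fold shift (word t) (Leaf # st) = t # st"
  by (induction t arbitrary: st) auto

lemma inj_word: "word s = word t \<Longrightarrow> s = t"
  by (metis fold_shift_word list.inject)

lemma stack_word_reduce: "stack_word (Node y x # st) = stack_word (x # y # st) @ [Down]"
  by (cases st) auto

text \<open>The parser loses no information on a path prefix: the stack spells the prefix, and its length
  records the height, one entry for each unmatched up step and one for the bottom.\<close>
lemma fold_shift_prefix:
  assumes "\<And>i. i \<le> length w \<Longrightarrow> height (take i w) \<ge> 0"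
  shows "int (length (fold shift w [Leaf])) = height w + 1 \<and> stack_word (fold shift w [Leaf]) = w"
  using assms
proof (induction w rule: rev_induct)
  case (snoc x w)
  have *: "height (take i w) \<ge> 0" if "i \<le> length w" for i
    using snoc.prems[of i] that by simp
  note IH = snoc.IH[OF *]
  show ?case
  proof (cases x)
    case Up
    then show ?thesis using IH by (cases "fold shift w [Leaf]") auto
  next
    case Down
    then have "height w \<ge> 1" using snoc.prems[of "Suc (length w)"] by simp
    then obtain a b st where "fold shift w [Leaf] = a # b # st"
      using IH by (cases "fold shift w [Leaf]"; cases "tl (fold shift w [Leaf])") auto
    then show ?thesis using IH Down by (simp add: stack_word_reduce)
  qed
qed simp

lemma fold_shift_dyck:
  assumes "dyck w"
  obtains t where "fold shift w [Leaf] = [t]" "word t = w"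
proof -
  have "int (length (fold shift w [Leaf])) = 1 \<and> stack_word (fold shift w [Leaf]) = w"
    using fold_shift_prefix[of w] assms by (simp add: dyck_def)
  then show ?thesis using that by (cases "fold shift w [Leaf]") auto
qed

lemma dyck_imp_word:
  assumes "dyck w" obtains t where "w = word t"
  using fold_shift_dyck[OF assms] by metis

lemma dyck_path_word [simp]: "dyck_path n (word t) \<longleftrightarrow> size t = n"
  by (simp add: dyck_path_def dyck_word)

lemma prime_dyck_word: "prime_dyck (word (Node Leaf x))"
  unfolding prime_dyck_def
proof (intro conjI allI impI)
  fix i assume i: "0 < i \<and> i < length (word (Node Leaf x))"
  then obtain j where "i = Suc j" "j \<le> length (word x)" by (cases i) auto
  then show "height (take i (word (Node Leaf x))) \<noteq> 0"
    using height_take_word_nonneg[of j x] by simp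
qed (rule dyck_word, simp)

lemma prime_dyck_imp_word:
  assumes "prime_dyck p" obtains x where "p = word (Node Leaf x)"
proof -
  obtain t where t: "p = word t" using assms dyck_imp_word unfolding prime_dyck_def by metis
  then obtain l x where lx: "t = Node l x" using assms by (cases t) (auto simp: prime_dyck_def)
  have "l = Leaf"
  proof (rule ccontr)
    assume "l \<noteq> Leaf"
    then have "0 < length (word l)" by (cases l) auto
    then show False using assms t lx unfolding prime_dyck_def
      by (auto dest!: spec[of _ "length (word l)"])
  qed
  then show ?thesis using that t lx by blast
qed

section \<open>Tamari covers are rotations\<close>

text \<open>In \<open>rotation a k s t\<close> the index \<open>k\<close> is the in-order position of the root of the rotated \<open>Node A B\<close>,
  and \<open>a\<close> is the position of the leftmost leaf of \<open>A\<close>. Hence \<open>{a..k}\<close> are the positions of the leaves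
  of \<open>A\<close>, and also those of the nodes of \<open>A\<close> together with that root.\<close>
inductive rotation :: "nat \<Rightarrow> nat \<Rightarrow> btree \<Rightarrow> btree \<Rightarrow> bool" where
  root: "rotation 0 (size A) (Node (Node A B) C) (Node A (Node B C))"
| left: "rotation a k l l' \<Longrightarrow> rotation a k (Node l r) (Node l' r)"
| right: "rotation a k r r' \<Longrightarrow>
    rotation (Suc (size l + a)) (Suc (size l + k)) (Node l r) (Node l r')"

lemma size_rotation: "rotation a k s t \<Longrightarrow> size t = size s"
  by (induction rule: rotation.induct) auto

lemma rotation_imp_word:
  "rotation a k s t \<Longrightarrow>
    \<exists>V p W. prime_dyck p \<and> word s = V @ [Down] @ p @ W \<and> word t = V @ p @ [Down] @ W"
proof (induction rule: rotation.induct)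
  case (root A B C)
  show ?case
    by (rule exI[of _ "word A @ Up # word B"], rule exI[of _ "word (Node Leaf C)"], rule exI[of _ "[]"])
      (use prime_dyck_word[of C] in simp)
next
  case (left a k l l' r)
  then obtain V p W where "prime_dyck p" "word l = V @ [Down] @ p @ W" "word l' = V @ p @ [Down] @ W"
    by blast
  then show ?case
    by (intro exI[of _ V] exI[of _ p] exI[of _ "W @ Up # word r @ [Down]"]) simp
next
  case (right a k r r' l)
  then obtain V p W where "prime_dyck p" "word r = V @ [Down] @ p @ W" "word r' = V @ p @ [Down] @ W"
    by blast
  then show ?case
    by (intro exI[of _ "word l @ Up # V"] exI[of _ p] exI[of _ "W @ [Down]"]) simp
qed

text \<open>The two sides of a cover are parsed in parallel: after the exchanged factor the two stacks
  differ by a rotation of one entry, and reading the common suffix preserves this.\<close>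
definition stack_rotation :: "btree list \<Rightarrow> btree list \<Rightarrow> bool" where
  "stack_rotation s s' \<longleftrightarrow>
    (\<exists>us x x' vs a k. rotation a k x x' \<and> s = us @ x # vs \<and> s' = us @ x' # vs)"

lemma stack_rotationI: "rotation a k x x' \<Longrightarrow> stack_rotation (us @ x # vs) (us @ x' # vs)"
  unfolding stack_rotation_def by blast

lemma stack_rotation_shift:
  assumes "stack_rotation s s'" shows "stack_rotation (shift c s) (shift c s')"
proof -
  obtain us x x' vs a k where
    rot: "rotation a k x x'" and s: "s = us @ x # vs" "s' = us @ x' # vs"
    using assms by (auto simp: stack_rotation_def)
  show ?thesis
  proof (cases c)
    case Up
    then show ?thesis using stack_rotationI[OF rot, of "Leaf # us" vs] s by simp
  next
    case Down
    consider "us = []" "vs = []" | y vs' where "us = []" "vs = y # vs'"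
      | u where "us = [u]" | u1 u2 us' where "us = u1 # u2 # us'"
      by (metis list.exhaust)
    then show ?thesis
    proof cases
      case 1
      then show ?thesis using assms Down s by simp
    next
      case 2
      then show ?thesis
        using stack_rotationI[OF rotation.right[OF rot, of y], of "[]" vs'] Down s by simp
    next
      case 3
      then show ?thesis
        using stack_rotationI[OF rotation.left[OF rot, of u], of "[]" vs] Down s by simp
    next
      case 4
      then show ?thesis
        using stack_rotationI[OF rot, of "Node u2 u1 # us'" vs] Down s by simp
    qed
  qed
qed

lemma stack_rotation_fold:
  "stack_rotation s s' \<Longrightarrow> stack_rotation (fold shift w s) (fold shift w s')"
  by (induction w arbitrary: s s') (auto simp: stack_rotation_shift)

text \<open>The down step of the cover joins the two top stack entries \<open>B\<close> and \<open>A\<close>. Reading it before the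
  prime factor of a tree \<open>x\<close> gives \<open>Node (Node A B) x\<close>, reading it after that factor gives
  \<open>Node A (Node B x)\<close>.\<close>
lemma tamari_cover_imp_rotation:
  assumes "tamari_cover n (word s) (word t)"
  obtains a k where "rotation a k s t"
proof -
  obtain V p W where p: "prime_dyck p"
    and s: "word s = V @ [Down] @ p @ W" and t: "word t = V @ p @ [Down] @ W"
    using assms unfolding tamari_cover_def by blast
  obtain x where x: "p = word (Node Leaf x)" using p prime_dyck_imp_word by metis
  have nonneg: "height (take i V) \<ge> 0" if "i \<le> length V" for i
    using height_take_word_nonneg[of i s] that by (simp add: s)
  have "height V \<ge> 1"
    using height_take_word_nonneg[of "Suc (length V)" s] by (simp add: s)
  then obtain B A st where V: "fold shift V [Leaf] = B # A # st"
    using fold_shift_prefix[of V] nonneg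
    by (cases "fold shift V [Leaf]"; cases "tl (fold shift V [Leaf])") auto
  have "fold shift (word s) [Leaf] = fold shift W (Node (Node A B) x # st)"
    unfolding s using V x fold_shift_word by simp
  moreover have "fold shift (word t) [Leaf] = fold shift W (Node A (Node B x) # st)"
    unfolding t using V x fold_shift_word by simp
  moreover have "stack_rotation (Node (Node A B) x # st) (Node A (Node B x) # st)"
    using stack_rotationI[OF rotation.root, of "[]"] by simp
  ultimately have "stack_rotation [s] [t]"
    using stack_rotation_fold by (metis fold_shift_word)
  then obtain us y y' vs a k where "rotation a k y y'" "[s] = us @ y # vs" "[t] = us @ y' # vs"
    unfolding stack_rotation_def by blast
  then show ?thesis using that by (cases us) auto
qed

lemma rotation_imp_tamari_cover:
  "rotation a k s t \<Longrightarrow> tamari_cover (size s) (word s) (word t)"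
  using rotation_imp_word size_rotation by (fastforce simp: tamari_cover_def)

section \<open>Right subtree sizes and left depths\<close>

text \<open>Entry \<open>k\<close> of \<open>right_sizes\<close> belongs to the \<open>k\<close>-th node in in-order, entry \<open>k\<close> of \<open>left_depths\<close> to the
  leaf immediately before that node; there is one more leaf, at the right end. The left depth of a
  leaf counts the left edges above it, starting from \<open>m\<close> at the root.\<close>
fun right_sizes :: "btree \<Rightarrow> nat list" where
  "right_sizes Leaf = []"
| "right_sizes (Node l r) = right_sizes l @ size r # right_sizes r"

fun left_depths :: "btree \<Rightarrow> int \<Rightarrow> int list" where
  "left_depths Leaf m = [m]"
| "left_depths (Node l r) m = left_depths l (m + 1) @ left_depths r m"

lemma length_right_sizes [simp]: "length (right_sizes t) = size t"
  by (induction t) auto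

lemma length_left_depths [simp]: "length (left_depths t m) = Suc (size t)"
  by (induction t arbitrary: m) auto

lemma left_depths_add: "left_depths t (m + c) = map (\<lambda>x. x + c) (left_depths t m)"
proof (induction t arbitrary: m)
  case (Node l r)
  show ?case using Node(1)[of "m + 1"] Node(2)[of m] by (simp add: algebra_simps)
qed simp

lemma last_left_depths: "left_depths t m ! size t = m"
  by (induction t arbitrary: m) (auto simp: nth_append)

lemma Node_index_cases:
  assumes "k < size (Node l r)"
  obtains (left) "k < size l" | (root) "k = size l"
    | (right) j where "k = Suc (size l + j)" "j < size r"
proof -
  consider "k < size l" | "k = size l" | "size l < k" by linarith
  then show ?thesis
  proof cases
    case 3
    then obtain j where "k = Suc (size l + j)" using less_imp_Suc_add by blast
    then show ?thesis using that(3) assms by simp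
  qed (use that in auto)
qed

lemma right_sizes_Node [simp]:
  "k < size l \<Longrightarrow> right_sizes (Node l r) ! k = right_sizes l ! k"
  "right_sizes (Node l r) ! size l = size r"
  "right_sizes (Node l r) ! Suc (size l + j) = right_sizes r ! j"
  by (auto simp: nth_append)

lemma left_depths_Node [simp]:
  "k \<le> size l \<Longrightarrow> left_depths (Node l r) m ! k = left_depths l (m + 1) ! k"
  "left_depths (Node l r) m ! Suc (size l + j) = left_depths r m ! j"
  by (auto simp: nth_append)

declare right_sizes.simps(2) [simp del] left_depths.simps(2) [simp del]

lemma right_sizes_bound: "k < size t \<Longrightarrow> k + right_sizes t ! k < size t"
proof (induction t arbitrary: k)
  case (Node l r)
  from Node.prems show ?case
  proof (cases rule: Node_index_cases)
    case left
    then show ?thesis using Node.IH(1)[of k] by simp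
  next
    case root
    then show ?thesis by simp
  next
    case (right j)
    then show ?thesis using Node.IH(2)[of j] by simp
  qed
qed simp

text \<open>A node with its right subtree occupies an interval of in-order indices. These intervals are
  nested or disjoint.\<close>
lemma right_sizes_laminar:
  "k < size t \<Longrightarrow> k \<le> m \<Longrightarrow> m \<le> k + right_sizes t ! k \<Longrightarrow>
    m + right_sizes t ! m \<le> k + right_sizes t ! k"
proof (induction t arbitrary: k m)
  case (Node l r)
  from Node.prems(1) show ?case
  proof (cases rule: Node_index_cases)
    case left
    then show ?thesis using Node.IH(1)[of k m] Node.prems right_sizes_bound[of k l]
      by simp
  next
    case root
    then show ?thesis
      using right_sizes_bound[of m "Node l r"] Node.prems
      by simp
  next
    case (right j)
    then obtain i where "m = Suc (size l + i)" using Node.prems(2)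
      by (metis Suc_le_D Suc_le_mono add_leD1 le_Suc_ex)
    then show ?thesis using right Node.IH(2)[of j i] Node.prems
      by simp
  qed
qed simp

text \<open>The root is recovered as the first node whose right subtree extends to the end of the tree.\<close>
lemma inj_right_sizes: "right_sizes s = right_sizes t \<Longrightarrow> s = t"
proof (induction s arbitrary: t)
  case Leaf
  then show ?case by (cases t) (auto simp: right_sizes.simps)
next
  case (Node l r)
  then obtain l' r' where t: "t = Node l' r'" by (cases t) (auto simp: right_sizes.simps)
  have size: "size (Node l r) = size (Node l' r')"
    using Node.prems t length_right_sizes by metis
  have root_minimal: "size x \<ge> size x'"
    if eq: "right_sizes (Node x y) = right_sizes (Node x' y')" for x y x' y'
  proof (rule ccontr)
    assume lt: "\<not> size x' \<le> size x"
    have "size (Node x y) = size (Node x' y')" using eq length_right_sizes by metis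
    moreover have "right_sizes x' ! size x = size y"
      using lt right_sizes_Node(1)[of "size x" x' y'] right_sizes_Node(2)[of x y] eq by simp
    ultimately show False using right_sizes_bound[of "size x" x'] lt by simp
  qed
  have "size l = size l'"
    using root_minimal[of l r l' r'] root_minimal[of l' r' l r] Node.prems t by simp
  then have "right_sizes l = right_sizes l'" "right_sizes r = right_sizes r'"
    using Node.prems t by (auto simp: right_sizes.simps)
  then show ?case using Node.IH t by simp
qed

lemma left_depths_last_node: "t \<noteq> Leaf \<Longrightarrow> left_depths t m ! (size t - 1) = m + 1"
proof (induction t arbitrary: m)
  case (Node l r)
  then show ?case
    using last_left_depths[of l "m + 1"] left_depths_Node(2)[of l r m "size r - 1"]
    by (cases r) auto
qed simp

text \<open>The leaf before a node is the last one of the node's left subtree, hence one left edge deeper than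
  the node itself. The last node of the right subtree is reached from the node by right edges, which
  do not change the left depth. This makes the distance of a tree to itself vanish.\<close>
lemma left_depths_subtree_end:
  "k < size t \<Longrightarrow> left_depths t m ! (k + right_sizes t ! k) = left_depths t m ! k"
proof (induction t arbitrary: k m)
  case (Node l r)
  from Node.prems show ?case
  proof (cases rule: Node_index_cases)
    case left
    then show ?thesis using Node.IH(1)[of k] right_sizes_bound[of k l] by simp
  next
    case root
    then show ?thesis
      using last_left_depths[of l "m + 1"] left_depths_Node(2)[of l r m "size r - 1"]
        left_depths_last_node[of r m]
      by (cases r) auto
  next
    case (right j)
    then show ?thesis
      using Node.IH(2)[of j] left_depths_Node(2)[of l r m "j + right_sizes r ! j"]
      by (simp add: add.assoc)
  qed
qed simp

lemma rotation_bounds: "rotation a k s t \<Longrightarrow> a \<le> k \<and> Suc (k + right_sizes s ! k) < size s"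
proof (induction rule: rotation.induct)
  case (root A B C)
  then show ?case by simp
next
  case (left a k l l' r)
  then show ?case by simp
next
  case (right a k r r' l)
  then show ?case by simp
qed

lemma rotation_left_depths:
  "rotation a k s t \<Longrightarrow> i \<le> size s \<Longrightarrow>
    left_depths t m ! i = left_depths s m ! i - (if a \<le> i \<and> i \<le> k then 1 else 0)"
proof (induction arbitrary: i m rule: rotation.induct)
  case (root A B C)
  have "left_depths A (m + 1 + 1) = map (\<lambda>x. x + 1) (left_depths A (m + 1))"
    using left_depths_add by blast
  then show ?case by (auto simp: left_depths.simps nth_append)
next
  case (left a k l l' r)
  then show ?case
    using rotation_bounds[of a k l l'] size_rotation[of a k l l']
    by (auto simp: left_depths.simps nth_append)
next
  case (right a k r r' l)
  then show ?case
    using size_rotation[of a k r r']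
    by (cases "i \<le> size l") (auto simp: left_depths.simps nth_append)
qed

lemma rotation_right_sizes:
  "rotation a k s t \<Longrightarrow> i < size s \<Longrightarrow>
    right_sizes t ! i =
      (if i = k then Suc (right_sizes s ! k + right_sizes s ! Suc (k + right_sizes s ! k))
       else right_sizes s ! i)"
proof (induction arbitrary: i rule: rotation.induct)
  case (root A B C)
  then show ?case by (auto simp: right_sizes.simps nth_append nth_Cons split: nat.splits)
next
  case (left a k l l' r)
  then have "Suc (k + right_sizes l ! k) < size l" "size l' = size l"
    using rotation_bounds size_rotation by blast+
  then show ?case using left by (auto simp: right_sizes.simps nth_append)
next
  case (right a k r r' l)
  then have "Suc (k + right_sizes r ! k) < size r" "size r' = size r"
    using rotation_bounds size_rotation by blast+
  note * = this right_sizes_Node(3)[of l r "Suc (k + right_sizes r ! k)"]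
  from right.prems show ?case
  proof (cases rule: Node_index_cases)
    case (right j)
    then show ?thesis using \<open>rotation a k r r'\<close> right.IH[of j] *
      by (simp add: add.assoc)
  qed (use * in auto)
qed

lemma rotation_inside:
  "rotation a k s t \<Longrightarrow> a \<le> i \<Longrightarrow> i < k \<Longrightarrow> i + right_sizes s ! i < k"
proof (induction arbitrary: i rule: rotation.induct)
  case (root A B C)
  then show ?case using right_sizes_bound[of i A] by simp
next
  case (left a k l l' r)
  then show ?case using rotation_bounds[of a k l l'] by simp
next
  case (right a k r r' l)
  then obtain j where "i = Suc (size l + j)" by (metis Suc_le_D Suc_le_mono add_leD1 le_Suc_ex)
  then show ?case using right by simp
qed

text \<open>If the part that is rotated does not start at the left end of the tree, then the node just before
  it is an ancestor with this part in its right subtree, so its right subtree reaches beyond \<open>k\<close>.\<close>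
lemma rotation_predecessor:
  "rotation (Suc b) k s t \<Longrightarrow> k < b + right_sizes t ! b"
proof (induction "Suc b" k s t arbitrary: b rule: rotation.induct)
  case (left k l l' r)
  then show ?case using rotation_bounds[of "Suc b" k l l'] size_rotation[of "Suc b" k l l'] by simp
next
  case (right a k r r' l)
  show ?case
  proof (cases a)
    case 0
    then show ?thesis using right rotation_bounds[of a k r r'] size_rotation[of a k r r'] by simp
  next
    case (Suc c)
    then show ?thesis using right by auto
  qed
qed

text \<open>A node can be rotated as soon as it is a left child. The right subtree of a right child ends where
  that of its parent ends, which the second assumption excludes; that of the root ends at the end of
  the tree, which the first assumption excludes.\<close>
lemma rotation_exists:
  assumes "Suc (k + right_sizes s ! k) < size s"
    and "\<And>m. m < k \<Longrightarrow> k \<le> m + right_sizes s ! m \<Longrightarrow> k + right_sizes s ! k < m + right_sizes s ! m"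
  shows "\<exists>a t. rotation a k s t"
  using assms
proof (induction s arbitrary: k)
  case (Node l r)
  have "k < size (Node l r)" using Node.prems(1) by simp
  then show ?case
  proof (cases rule: Node_index_cases)
    case left
    have inner: "k + right_sizes l ! k < m + right_sizes l ! m"
      if "m < k" "k \<le> m + right_sizes l ! m" for m
      using Node.prems(2)[of m] that left by simp
    consider "Suc (k + right_sizes l ! k) < size l" | "Suc (k + right_sizes l ! k) = size l"
      using right_sizes_bound[OF left] by linarith
    then show ?thesis
    proof cases
      case 1
      then show ?thesis using Node.IH(1)[OF 1 inner] rotation.left by blast
    next
      case 2
      then obtain A B where l: "l = Node A B" by (cases l) auto
      have "k = size A"
      proof (rule ccontr)
        assume "k \<noteq> size A"
        then consider "k < size A" | "size A < k" by linarith
        then show False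
        proof cases
          case 1
          then show ?thesis using 2 right_sizes_bound[of k A] l by simp
        next
          case 2
          then show ?thesis
            using inner[of "size A"] left \<open>Suc (k + right_sizes l ! k) = size l\<close> l by simp
        qed
      qed
      then show ?thesis using l rotation.root by blast
    qed
  next
    case root
    then show ?thesis using Node.prems(1) by simp
  next
    case (right j)
    have "j + right_sizes r ! j < m + right_sizes r ! m"
      if "m < j" "j \<le> m + right_sizes r ! m" for m
      using Node.prems(2)[of "Suc (size l + m)"] that right by simp
    then show ?thesis using Node.IH(2)[of j] Node.prems(1) right rotation.right by fastforce
  qed
qed simp

section \<open>The distance potential\<close>

text \<open>This componentwise order coincides with the Tamari order: a rotation increases one component,
  and the converse is the existence of chains of rotations shown below.\<close>
definition subtree_le :: "btree \<Rightarrow> btree \<Rightarrow> bool" where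
  "subtree_le s t \<longleftrightarrow> size s = size t \<and> (\<forall>i < size s. right_sizes s ! i \<le> right_sizes t ! i)"

definition rotation_distance :: "btree \<Rightarrow> btree \<Rightarrow> int" where
  "rotation_distance s t =
    (\<Sum>i<size s. left_depths s 0 ! i - left_depths s 0 ! (i + right_sizes t ! i))"

lemma rotation_distance_self [simp]: "rotation_distance t t = 0"
  by (simp add: rotation_distance_def left_depths_subtree_end)

lemma subtree_le_rotation: "rotation a k s t \<Longrightarrow> subtree_le s t"
  using right_sizes_bound
  by (auto simp: subtree_le_def size_rotation rotation_right_sizes)

text \<open>Left depths drop on \<open>{a..k}\<close> only, so the summand of \<open>i\<close> changes only if exactly one of \<open>i\<close> and
  \<open>i + right_sizes q ! i\<close> lies in that interval. For \<open>i < a\<close> the latter never does: otherwise, by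
  laminarity in \<open>q\<close>, the interval of \<open>i\<close> would contain that of \<open>a - 1\<close>, which reaches beyond \<open>k\<close>.\<close>
lemma rotation_distance_step:
  assumes rot: "rotation a k s t" and le: "subtree_le t q"
  shows "rotation_distance s q =
    rotation_distance t q + int (card {i \<in> {a..k}. k < i + right_sizes q ! i})"
proof -
  have size: "size t = size s" "size q = size s"
    using size_rotation[OF rot] le by (auto simp: subtree_le_def)
  have le': "i < size s \<Longrightarrow> right_sizes t ! i \<le> right_sizes q ! i" for i
    using le size by (auto simp: subtree_le_def)
  note bounds = rotation_bounds[OF rot]
  have skip: "\<not> (a \<le> i + right_sizes q ! i \<and> i + right_sizes q ! i \<le> k)" if less: "i < a" for i
  proof
    assume *: "a \<le> i + right_sizes q ! i \<and> i + right_sizes q ! i \<le> k"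
    obtain b where b: "a = Suc b" using less by (cases a) auto
    have "k < b + right_sizes t ! b" using rotation_predecessor rot b by blast
    also have "\<dots> \<le> b + right_sizes q ! b" using le'[of b] bounds b by simp
    also have "\<dots> \<le> i + right_sizes q ! i"
      using right_sizes_laminar[of i q b] less b * bounds size by simp
    finally show False using * by simp
  qed
  have "rotation_distance s q - rotation_distance t q =
    (\<Sum>i<size s. if a \<le> i \<and> i \<le> k \<and> k < i + right_sizes q ! i then 1 else 0)"
    unfolding rotation_distance_def size(1) sum_subtractf[symmetric]
  proof (rule sum.cong[OF refl])
    fix i assume "i \<in> {..<size s}"
    then have i: "i < size s" "i + right_sizes q ! i \<le> size s"
      using right_sizes_bound[of i q] size by auto
    show "left_depths s 0 ! i - left_depths s 0 ! (i + right_sizes q ! i) -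
      (left_depths t 0 ! i - left_depths t 0 ! (i + right_sizes q ! i)) =
      (if a \<le> i \<and> i \<le> k \<and> k < i + right_sizes q ! i then 1 else 0)"
      using rotation_left_depths[OF rot, of i 0] i skip[of i]
        rotation_left_depths[OF rot, of "i + right_sizes q ! i" 0] by auto
  qed
  also have "\<dots> = int (card {i \<in> {..<size s}. a \<le> i \<and> i \<le> k \<and> k < i + right_sizes q ! i})"
    by (subst sum.inter_filter[symmetric]) auto
  also have "{i \<in> {..<size s}. a \<le> i \<and> i \<le> k \<and> k < i + right_sizes q ! i} =
    {i \<in> {a..k}. k < i + right_sizes q ! i}"
    using bounds by auto
  finally show ?thesis by simp
qed

lemma rotation_distance_decreases:
  assumes rot: "rotation a k s t" and le: "subtree_le t q"
  shows "rotation_distance t q + 1 \<le> rotation_distance s q"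
proof -
  have "k < size s" using rotation_bounds[OF rot] by simp
  then have "0 < right_sizes q ! k"
    using rotation_right_sizes[OF rot, of k] le size_rotation[OF rot]
    by (auto simp: subtree_le_def dest!: spec[of _ k])
  then have "k \<in> {i \<in> {a..k}. k < i + right_sizes q ! i}"
    using rotation_bounds[OF rot] by simp
  then have "0 < card {i \<in> {a..k}. k < i + right_sizes q ! i}"
    by (subst card_gt_0_iff) auto
  then show ?thesis using rotation_distance_step[OF rot le] by simp
qed

text \<open>Choosing the first node whose right subtree is too small guarantees both that a rotation is
  possible there and that the nodes of \<open>{a..k}\<close> before \<open>k\<close> already have right subtrees of their final
  sizes, which end before \<open>k\<close>; only \<open>k\<close> itself then contributes to the drop in the distance.\<close>
lemma unit_rotation_exists:
  assumes le: "subtree_le s q" and ne: "s \<noteq> q"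
  obtains a k t where "rotation a k s t" "subtree_le t q"
    "rotation_distance s q = rotation_distance t q + 1"
proof -
  have size: "size q = size s" and le': "\<And>i. i < size s \<Longrightarrow> right_sizes s ! i \<le> right_sizes q ! i"
    using le by (auto simp: subtree_le_def)
  define k where "k = (LEAST i. i < size s \<and> right_sizes s ! i \<noteq> right_sizes q ! i)"
  have "\<exists>i. i < size s \<and> right_sizes s ! i \<noteq> right_sizes q ! i"
    using ne inj_right_sizes[of s q] size nth_equalityI[of "right_sizes s" "right_sizes q"] by auto
  from LeastI_ex[OF this] have k: "k < size s" "right_sizes s ! k < right_sizes q ! k"
    using le'[of k] unfolding k_def[symmetric] by auto
  have least: "right_sizes s ! i = right_sizes q ! i" if "i < k" for i
    using not_less_Least[of i "\<lambda>i. i < size s \<and> right_sizes s ! i \<noteq> right_sizes q ! i"] that k(1)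
    unfolding k_def[symmetric] by auto
  have q_bound: "k + right_sizes q ! k < size s" using right_sizes_bound[of k q] k size by simp
  have "\<exists>a t. rotation a k s t"
  proof (rule rotation_exists)
    show "Suc (k + right_sizes s ! k) < size s" using q_bound k by simp
    fix m assume m: "m < k" "k \<le> m + right_sizes s ! m"
    then show "k + right_sizes s ! k < m + right_sizes s ! m"
      using right_sizes_laminar[of m q k] least[of m] k size by simp
  qed
  then obtain a t where rot: "rotation a k s t" by blast
  \<comment> \<open>The rotation appends the node \<open>?m\<close> and its right subtree to the right subtree of \<open>k\<close>. Laminarity
    in \<open>q\<close> keeps the result within the size of the right subtree of \<open>k\<close> in \<open>q\<close>.\<close>
  let ?m = "Suc (k + right_sizes s ! k)"
  have "?m + right_sizes s ! ?m \<le> ?m + right_sizes q ! ?m" using le'[of ?m] q_bound k by simp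
  also have "\<dots> \<le> k + right_sizes q ! k" using right_sizes_laminar[of k q ?m] k size by simp
  finally have le_t: "subtree_le t q"
    using rotation_right_sizes[OF rot] size_rotation[OF rot] size le' by (auto simp: subtree_le_def)
  have "{i \<in> {a..k}. k < i + right_sizes q ! i} = {k}"
    using rotation_inside[OF rot] least rotation_bounds[OF rot] k by (force simp: le_less)
  then show ?thesis using that[OF rot le_t] rotation_distance_step[OF rot le_t] by simp
qed

definition rotates :: "btree \<Rightarrow> btree \<Rightarrow> bool" where
  "rotates s t \<longleftrightarrow> (\<exists>a k. rotation a k s t)"

lemma rotatesI: "rotation a k s t \<Longrightarrow> rotates s t"
  by (auto simp: rotates_def)

lemma rotatesE: assumes "rotates s t" obtains a k where "rotation a k s t"
  using assms by (auto simp: rotates_def)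

lemma rotation_chain:
  "subtree_le s q \<Longrightarrow> \<exists>m. (rotates ^^ m) s q \<and> int m = rotation_distance s q"
proof (induction "\<Sum>i<size s. right_sizes q ! i - right_sizes s ! i" arbitrary: s rule: less_induct)
  case less
  show ?case
  proof (cases "s = q")
    case True
    then show ?thesis by (intro exI[of _ 0]) simp
  next
    case False
    then obtain a k t where t: "rotation a k s t" "subtree_le t q"
      "rotation_distance s q = rotation_distance t q + 1"
      using unit_rotation_exists less.prems by metis
    have k: "k < size s" using rotation_bounds[OF t(1)] by simp
    have "(\<Sum>i<size t. right_sizes q ! i - right_sizes t ! i) <
      (\<Sum>i<size s. right_sizes q ! i - right_sizes s ! i)"
      unfolding size_rotation[OF t(1)]
    proof (rule sum_strict_mono_ex1)
      show "\<forall>i\<in>{..<size s}. right_sizes q ! i - right_sizes t ! i \<le> right_sizes q ! i - right_sizes s ! i"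
        using rotation_right_sizes[OF t(1)] by auto
      show "\<exists>i\<in>{..<size s}. right_sizes q ! i - right_sizes t ! i < right_sizes q ! i - right_sizes s ! i"
        using rotation_right_sizes[OF t(1) k] t(2) k size_rotation[OF t(1)]
        by (intro bexI[of _ k]) (auto simp: subtree_le_def dest!: spec[of _ k])
    qed simp
    from less.hyps[OF this t(2)] obtain m where
      "(rotates ^^ m) t q" "int m = rotation_distance t q" by blast
    moreover have "rotates s t" using t(1) by (rule rotatesI)
    ultimately show ?thesis
      using t(3) relpowp_Suc_I2[of rotates s t m q] by (intro exI[of _ "Suc m"]) simp
  qed
qed

section \<open>The longest chains\<close>

lemma rotations_imp_tamari_le:
  "rotates\<^sup>*\<^sup>* s t \<Longrightarrow> tamari_le (size s) (word s) (word t)"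
proof (induction rule: rtranclp_induct)
  case base
  then show ?case by (simp add: tamari_le_def)
next
  case (step t u)
  then have "size t = size s" by (simp add: tamari_le_def)
  then have "tamari_cover (size s) (word t) (word u)"
    using step.hyps(2) rotation_imp_tamari_cover rotatesE by metis
  moreover from this have "dyck_path (size s) (word u)" by (simp add: tamari_cover_def)
  ultimately show ?case
    using step.IH unfolding tamari_le_def by (meson rtranclp.rtrancl_into_rtrancl)
qed

lemma tamari_le_imp_rotations:
  assumes "tamari_le n (word s) (word t)"
  shows "rotates\<^sup>*\<^sup>* s t"
proof -
  have "(tamari_cover n)\<^sup>*\<^sup>* P Q \<Longrightarrow> P = word s \<Longrightarrow> \<forall>t. Q = word t \<longrightarrow> rotates\<^sup>*\<^sup>* s t" for P Q
  proof (induction rule: rtranclp_induct)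
    case base
    then show ?case using inj_word by auto
  next
    case (step Q R)
    obtain u where u: "Q = word u"
      using step.hyps(2) dyck_imp_word unfolding tamari_cover_def dyck_path_def by metis
    show ?case
    proof (intro allI impI)
      fix t assume t: "R = word t"
      then have "rotates u t" using step.hyps(2) u tamari_cover_imp_rotation rotatesI by metis
      then show "rotates\<^sup>*\<^sup>* s t"
        using step.IH step.prems u rtranclp.rtrancl_into_rtrancl[of rotates s u t] by blast
    qed
  qed
  then show ?thesis using assms by (auto simp: tamari_le_def)
qed

lemma subtree_le_trans: "subtree_le s t \<Longrightarrow> subtree_le t u \<Longrightarrow> subtree_le s u"
  unfolding subtree_le_def by (metis order_trans)

lemma rotations_imp_subtree_le: "rotates\<^sup>*\<^sup>* s t \<Longrightarrow> subtree_le s t"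
  by (induction rule: rtranclp_induct)
    (auto simp: subtree_le_def[of s s] elim!: rotatesE intro: subtree_le_rotation subtree_le_trans)

lemma rotations_distance_mono:
  "rotates\<^sup>*\<^sup>* s t \<Longrightarrow> subtree_le t q \<Longrightarrow> rotation_distance t q \<le> rotation_distance s q"
proof (induction rule: converse_rtranclp_induct)
  case (step s u)
  then obtain a k where "rotation a k s u" using rotatesE by blast
  moreover have "subtree_le u q"
    using subtree_le_trans[OF rotations_imp_subtree_le] step.hyps(2) step.prems by blast
  ultimately show ?case using step.IH step.prems rotation_distance_decreases[of a k s u q] by simp
qed simp

lemma rotations_distance_strict_mono:
  assumes "rotates\<^sup>*\<^sup>* s t" "s \<noteq> t" "subtree_le t q"
  shows "rotation_distance t q + 1 \<le> rotation_distance s q"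
proof -
  obtain u where u: "rotates s u" "rotates\<^sup>*\<^sup>* u t"
    using assms(1,2) by (cases rule: converse_rtranclpE) auto
  obtain a k where rot: "rotation a k s u" using u(1) by (rule rotatesE)
  have "subtree_le u q" using subtree_le_trans[OF rotations_imp_subtree_le[OF u(2)] assms(3)] .
  then show ?thesis
    using rotation_distance_decreases[OF rot] rotations_distance_mono[OF u(2) assms(3)] by fastforce
qed

lemma tamari_chain_length_le:
  assumes "C 0 = word s" "C m = word q" "\<forall>i<m. tamari_less n (C i) (C (Suc i))"
  shows "int m \<le> rotation_distance s q"
  using assms
proof (induction m arbitrary: C s)
  case 0
  then show ?case using inj_word[of s q] by simp
next
  case (Suc m)
  have all_dyck: "dyck (C i)" if "i \<le> Suc m" for i
  proof (cases i)
    case (Suc j)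
    then show ?thesis
      using that Suc.prems(3) by (auto simp: tamari_less_def tamari_le_def dyck_path_def)
  qed (simp add: Suc.prems dyck_word)
  obtain t where t: "C 1 = word t" using all_dyck[of 1] dyck_imp_word by auto
  have "tamari_less n (word s) (word t)" using Suc.prems(1,3) t by auto
  then have st: "rotates\<^sup>*\<^sup>* s t" "s \<noteq> t"
    using tamari_le_imp_rotations unfolding tamari_less_def by auto
  have le: "subtree_le t q"
  proof -
    have "\<forall>u. C (Suc i) = word u \<longrightarrow> subtree_le t u" if "i \<le> m" for i
      using that
    proof (induction i)
      case 0
      then show ?case using t inj_word by (fastforce simp: subtree_le_def)
    next
      case (Suc i)
      obtain v where v: "C (Suc i) = word v" using Suc.prems all_dyck[of "Suc i"] dyck_imp_word by auto
      show ?case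
      proof (intro allI impI)
        fix u assume u: "C (Suc (Suc i)) = word u"
        have "tamari_less n (word v) (word u)"
          using \<open>\<forall>i<Suc m. tamari_less n (C i) (C (Suc i))\<close> Suc.prems u v
          by (metis Suc_le_lessD less_Suc_eq_le Suc_less_eq)
        then have "subtree_le v u"
          unfolding tamari_less_def
          using tamari_le_imp_rotations rotations_imp_subtree_le by blast
        moreover have "subtree_le t v" using Suc.IH Suc.prems v by simp
        ultimately show "subtree_le t u" using subtree_le_trans by blast
      qed
    qed
    then show ?thesis using Suc.prems(2) by blast
  qed
  have "int m \<le> rotation_distance t q"
    using Suc.IH[of "\<lambda>i. C (Suc i)" t] Suc.prems t by simp
  then show ?case using rotations_distance_strict_mono[OF st le] by simp
qed

lemma rotation_neq: "rotation a k s t \<Longrightarrow> s \<noteq> t"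
  using rotation_bounds[of a k s t] rotation_right_sizes[of a k s t k] by auto

lemma tamari_distance_word:
  assumes "tamari_le n (word s) (word q)"
  shows "int (tamari_distance n (word s, word q)) = rotation_distance s q"
proof -
  obtain m where m: "(rotates ^^ m) s q" "int m = rotation_distance s q"
    using assms tamari_le_imp_rotations rotations_imp_subtree_le rotation_chain by metis
  obtain C where C: "C 0 = s" "C m = q" "\<forall>i<m. rotates (C i) (C (Suc i))"
    using m(1) unfolding relpowp_fun_conv by blast
  have size: "size (C i) = n" if "i \<le> m" for i
    using that
  proof (induction i)
    case 0
    then show ?case using C assms by (simp add: tamari_le_def)
  next
    case (Suc i)
    then show ?case using C(3) size_rotation by (metis Suc_le_lessD less_imp_le_nat rotatesE)
  qed
  have chain: "tamari_less n (word (C i)) (word (C (Suc i)))" if "i < m" for i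
  proof -
    have "rotates (C i) (C (Suc i))" using C(3) that by blast
    then have "word (C i) \<noteq> word (C (Suc i))"
      using rotation_neq inj_word by (metis rotatesE)
    moreover have "tamari_le n (word (C i)) (word (C (Suc i)))"
      using rotations_imp_tamari_le[OF r_into_rtranclp, of "C i" "C (Suc i)"]
        \<open>rotates (C i) (C (Suc i))\<close> size[of i] that
      by simp
    ultimately show ?thesis by (simp add: tamari_less_def)
  qed
  let ?S = "{k. \<exists>C :: nat \<Rightarrow> step list. C 0 = word s \<and> C k = word q \<and>
     (\<forall>i<k. tamari_less n (C i) (C (Suc i)))}"
  have bound: "k \<le> m" if "k \<in> ?S" for k
  proof -
    from that[unfolded mem_Collect_eq] obtain D where
      "D 0 = word s \<and> D k = word q \<and> (\<forall>i<k. tamari_less n (D i) (D (Suc i)))"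
      by (rule exE)
    then have "int k \<le> rotation_distance s q" using tamari_chain_length_le[of D s k q n] by simp
    then show ?thesis using m(2) by simp
  qed
  have "Max ?S = m"
  proof (rule Max_eqI)
    show "finite ?S"
      using bound by (rule finite_subset[OF subsetI[OF atMost_iff[THEN iffD2]] finite_atMost])
    show "m \<in> ?S"
      using C(1,2) chain by (intro CollectI exI[of _ "\<lambda>i. word (C i)"] conjI allI impI) simp_all
  qed (rule bound)
  then show ?thesis using m(2) by (simp add: tamari_distance_def)
qed

section \<open>Contact vectors\<close>

text \<open>The number of nodes on the leftmost branch. Each of them stands for one prime factor of the word.\<close>
fun left_spine :: "btree \<Rightarrow> nat" where
  "left_spine Leaf = 0"
| "left_spine (Node l r) = Suc (left_spine l)"

fun right_subtrees :: "btree \<Rightarrow> btree list" where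
  "right_subtrees Leaf = []"
| "right_subtrees (Node l r) = right_subtrees l @ r # right_subtrees r"

lemma length_right_subtrees [simp]: "length (right_subtrees t) = size t"
  by (induction t) auto

lemma noninitial_contacts_word: "noninitial_contacts (word t) = left_spine t"
proof (induction t)
  case (Node l r)
  let ?w = "word (Node l r)"
  let ?c = "\<lambda>w. {i. 0 < i \<and> i \<le> length w \<and> height (take i w) = 0}"
  have "?c ?w = insert (length ?w) (?c (word l))"
  proof (intro set_eqI iffI)
    fix i assume i: "i \<in> ?c ?w"
    show "i \<in> insert (length ?w) (?c (word l))"
    proof (cases "i \<le> length (word l)")
      case True
      then show ?thesis using i by simp
    next
      case False
      then obtain j where j: "i = length (word l) + Suc j"
        by (metis add_Suc_right less_imp_Suc_add not_le)
      show ?thesis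
      proof (cases "j \<le> length (word r)")
        case True
        then show ?thesis using i j height_take_word_nonneg[of j r] by simp
      next
        case False
        then show ?thesis using i j by simp
      qed
    qed
  next
    fix i assume "i \<in> insert (length ?w) (?c (word l))"
    then consider "i = length ?w" | "i \<in> ?c (word l)" by blast
    then show "i \<in> ?c ?w"
    proof cases
      case 1
      then show ?thesis using height_word[of "Node l r"] by simp
    qed simp
  qed
  then show ?case using Node(1) by (simp add: noninitial_contacts_def)
qed (auto simp: noninitial_contacts_def)

lemma maximal_dyck_prefix_word: "maximal_dyck_prefix (word t @ Down # v) = word t"
proof -
  have "(GREATEST m. m \<le> length (word t @ Down # v) \<and> dyck (take m (word t @ Down # v))) =
    length (word t)"
  proof (rule Greatest_equality)
    fix m assume m: "m \<le> length (word t @ Down # v) \<and> dyck (take m (word t @ Down # v))"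
    show "m \<le> length (word t)"
    proof (rule ccontr)
      assume less: "\<not> m \<le> length (word t)"
      then have "height (take (Suc (length (word t))) (take m (word t @ Down # v))) \<ge> 0"
        using m unfolding dyck_def by (metis Suc_leI length_take min.absorb2 not_le)
      moreover have "min (Suc (length (word t))) m = Suc (length (word t))" using less by simp
      ultimately show False by (simp add: take_take del: take_append) simp
    qed
  qed (simp add: dyck_word)
  then show ?thesis by (simp add: maximal_dyck_prefix_def)
qed

lemma after_up_word_skip: "after_up (size t + Suc k) (word t @ v) = after_up (Suc k) v"
proof (induction t arbitrary: k v)
  case (Node l r)
  have "after_up (size (Node l r) + Suc k) (word (Node l r) @ v) =
    after_up (size l + Suc (size r + Suc k)) (word l @ Up # word r @ Down # v)"
    by (simp add: algebra_simps)
  also have "\<dots> = after_up (size r + Suc k) (word r @ Down # v)"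
    unfolding Node(1) by simp
  also have "\<dots> = after_up (Suc k) v" unfolding Node(2) by simp
  finally show ?case .
qed simp

text \<open>After the up step of a node comes the word of its right subtree and then the matching down step,
  so this word is the maximal Dyck factor that follows the up step.\<close>
lemma after_up_word:
  "k < size t \<Longrightarrow> \<exists>v'. after_up (Suc k) (word t @ v) = word (right_subtrees t ! k) @ Down # v'"
proof (induction t arbitrary: k v)
  case (Node l r)
  from Node.prems show ?case
  proof (cases rule: Node_index_cases)
    case left
    then show ?thesis using Node.IH(1)[of k "Up # word r @ Down # v"] by (simp add: nth_append)
  next
    case root
    then show ?thesis using after_up_word_skip[of l 0 "Up # word r @ Down # v"] by (simp add: nth_append)
  next
    case (right j)
    then show ?thesis
      using after_up_word_skip[of l "Suc j" "Up # word r @ Down # v"] Node.IH(2)[of j "Down # v"]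
      by (simp add: nth_append)
  qed
qed simp

lemma path_contact_word:
  "path_contact (word t) 0 = left_spine t"
  "k < size t \<Longrightarrow> path_contact (word t) (Suc k) = left_spine (right_subtrees t ! k)"
  using after_up_word[of k t "[]"]
  by (auto simp: path_contact_def noninitial_contacts_word maximal_dyck_prefix_word
      simp del: after_up.simps)

lemma left_depths_first: "left_depths t m ! 0 = m + int (left_spine t)"
  by (induction t arbitrary: m) (auto simp: left_depths.simps(1))

text \<open>Going from a leaf to the next one past the node in between, the left depth loses the left edge
  that leaves this node and gains the leftmost branch of its right subtree.\<close>
lemma left_depths_Suc:
  "k < size t \<Longrightarrow>
    left_depths t m ! Suc k = left_depths t m ! k + int (left_spine (right_subtrees t ! k)) - 1"
proof (induction t arbitrary: k m)
  case (Node l r)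
  from Node.prems show ?case
  proof (cases rule: Node_index_cases)
    case left
    then show ?thesis using Node.IH(1)[of k] by (simp add: nth_append)
  next
    case root
    then show ?thesis
      using last_left_depths[of l "m + 1"] left_depths_first[of r m] left_depths_Node(2)[of l r m 0]
      by (simp add: nth_append)
  next
    case (right j)
    then show ?thesis
      using Node.IH(2)[of j] left_depths_Node(2)[of l r m "Suc j"] by (simp add: nth_append)
  qed
qed simp

lemma sum_contacts:
  "j \<le> size t \<Longrightarrow>
    (\<Sum>i<Suc j. int (path_contact (word t) i) - 1) = left_depths t 0 ! j - 1"
proof (induction j)
  case 0
  then show ?case by (simp add: path_contact_word left_depths_first)
next
  case (Suc j)
  then show ?case using left_depths_Suc[of j t 0] path_contact_word(2)[of j t] by simp
qed

section \<open>Descent vectors\<close>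

text \<open>The lengths of the runs of down steps in reading order, hence the descent vector reversed. The
  first run precedes all up steps.\<close>
fun descents :: "step list \<Rightarrow> nat list" where
  "descents [] = [0]"
| "descents (Up # w) = 0 # descents w"
| "descents (Down # w) = (case descents w of d # ds \<Rightarrow> Suc d # ds)"

abbreviation blocks :: "nat list \<Rightarrow> step list" where
  "blocks ds \<equiv> concat (map (\<lambda>d. Up # replicate d Down) ds)"

lemma length_descents [simp]: "length (descents w) = Suc (count_list w Up)"
  by (induction w rule: descents.induct) (auto split: list.splits)

lemma descents_nonempty [simp]: "descents w \<noteq> []"
  by (metis length_descents length_0_conv nat.distinct(1))

lemma descents_replicate: "descents w = e # es \<Longrightarrow> descents (replicate d Down @ w) = (d + e) # es"
  by (induction d) auto

lemma descents_blocks: "descents (replicate d Down @ blocks ds) = d # ds"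
proof (induction ds arbitrary: d)
  case Nil
  show ?case using descents_replicate[of "[]" 0 "[]" d] by simp
next
  case (Cons e ds)
  show ?case
    using descents_replicate[of "blocks (e # ds)" 0 "e # ds" d] Cons by simp
qed

lemma word_of_descents_rev: "word_of_descents (rev (d # ds)) = replicate d Down @ blocks ds"
  by (simp add: word_of_descents_def)

lemma word_of_descents_descents: "word_of_descents (rev (descents w)) = w"
proof (induction w rule: descents.induct)
  case 1
  then show ?case by (simp add: word_of_descents_def)
next
  case (2 w)
  then show ?case by (cases "descents w") (simp_all only: word_of_descents_rev descents.simps, simp_all)
next
  case (3 w)
  then show ?case by (cases "descents w") (simp_all only: word_of_descents_rev descents.simps list.case, simp_all)
qed

lemma descent_vector_eq: "descent_vector w = rev (descents w)"
  unfolding descent_vector_def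
proof (rule the_equality)
  fix ds assume ds: "length ds = Suc (count_list w Up) \<and> w = word_of_descents ds"
  then obtain e es where e: "ds = rev (e # es)" by (cases "rev ds") (auto simp: rev_swap)
  then have "w = replicate e Down @ blocks es" using ds word_of_descents_rev by metis
  then show "ds = rev (descents w)" using e descents_blocks by metis
qed (simp add: word_of_descents_descents)

lemma path_descent_eq:
  "j \<le> count_list w Up \<Longrightarrow> path_descent w (count_list w Up - j) = descents w ! j"
  by (simp add: path_descent_def descent_vector_eq rev_nth)

text \<open>The sum over all down steps of the value of \<open>g\<close> at the number of up steps read before, when \<open>p\<close>
  of them were read in advance. Grouping the down steps by runs leads to the descent vector,
  attributing each to its matching up step leads to the right subtree sizes.\<close>
fun down_sum :: "(nat \<Rightarrow> int) \<Rightarrow> step list \<Rightarrow> nat \<Rightarrow> int" where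
  "down_sum g [] p = 0"
| "down_sum g (Up # w) p = down_sum g w (Suc p)"
| "down_sum g (Down # w) p = g p + down_sum g w p"

lemma down_sum_append:
  "down_sum g (v @ w) p = down_sum g v p + down_sum g w (p + count_list v Up)"
  by (induction g v p rule: down_sum.induct) auto

lemma down_sum_descents:
  "down_sum g w p = (\<Sum>j<Suc (count_list w Up). g (p + j) * int (descents w ! j))"
proof (induction g w p rule: down_sum.induct)
  case (2 g w p)
  show ?case by (subst sum.lessThan_Suc_shift) (simp add: 2)
next
  case (3 g w p)
  obtain d ds where d: "descents w = d # ds" by (cases "descents w") auto
  then show ?case
    by (simp add: 3 d sum.lessThan_Suc_shift algebra_simps del: sum.lessThan_Suc)
qed simp

lemma sum_lessThan_Suc_add:
  fixes f :: "nat \<Rightarrow> int"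
  shows "(\<Sum>k<Suc (a + b). f k) = (\<Sum>k<a. f k) + f a + (\<Sum>k<b. f (Suc (a + k)))"
  by (induction b) simp_all

lemma down_sum_word:
  "down_sum g (word t) p = (\<Sum>k<size t. g (p + Suc (k + right_sizes t ! k)))"
proof (induction t arbitrary: p)
  case (Node l r)
  have split: "(\<Sum>k<size (Node l r). f k) =
    (\<Sum>k<size l. f k) + f (size l) + (\<Sum>k<size r. f (Suc (size l + k)))" for f :: "nat \<Rightarrow> int"
    using sum_lessThan_Suc_add[of f "size l" "size r"] by simp
  show ?case
    unfolding split
    by (simp add: down_sum_append Node add.assoc)
qed simp

section \<open>The formula\<close>

theorem theorem4:
  fixes n :: nat and I :: "step list \<times> step list"
  assumes "tamari_interval n I"
  shows "int (tamari_distance n I) =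
    (\<Sum>(i, j) \<in> {(i, j). i < j \<and> j \<le> n}. (int (contact I i) - 1) * (1 - int (descent I (n - j))))"
proof -
  obtain P Q where I: "I = (P, Q)" by (cases I)
  have le: "tamari_le n P Q" using assms I by (simp add: tamari_interval_def)
  then obtain p q where pq: "P = word p" "Q = word q"
    using dyck_imp_word unfolding tamari_le_def dyck_path_def by metis
  have size: "size p = n" "size q = n" using le pq by (auto simp: tamari_le_def)
  \<comment> \<open>Summing over \<open>i\<close> first turns the double sum into one over \<open>j\<close> with the weights \<open>g j\<close>, the
    partial sums of the contact vector lowered by one.\<close>
  define c where "c i = int (contact I i) - 1" for i
  define d where "d j = int (descents Q ! j)" for j
  define g where "g j = (\<Sum>i<j. c i)" for j
  have g: "g (Suc j) = left_depths p 0 ! j - 1" if "j \<le> n" for j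
    using sum_contacts[of j p] that size I pq by (simp add: g_def c_def contact_def)
  have "(\<Sum>(i, j) \<in> {(i, j). i < j \<and> j \<le> n}. (int (contact I i) - 1) * (1 - int (descent I (n - j))))
    = (\<Sum>(j, i) \<in> Sigma {..n} (\<lambda>j. {..<j}). c i * (1 - int (descent I (n - j))))"
    by (rule sum.reindex_bij_witness[of _ prod.swap prod.swap]) (auto simp: c_def)
  also have "\<dots> = (\<Sum>j\<le>n. \<Sum>i<j. c i * (1 - int (descent I (n - j))))"
    by (subst sum.Sigma) auto
  also have "\<dots> = (\<Sum>j\<le>n. g j * (1 - d j))"
  proof (rule sum.cong[OF refl])
    fix j assume "j \<in> {..n}"
    then have "int (descent I (n - j)) = d j"
      using path_descent_eq[of j Q] size I pq by (simp add: descent_def d_def)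
    then show "(\<Sum>i<j. c i * (1 - int (descent I (n - j)))) = g j * (1 - d j)"
      by (simp add: g_def sum_distrib_right)
  qed
  also have "\<dots> = (\<Sum>j<Suc n. g j) - (\<Sum>j<Suc n. g (0 + j) * d j)"
    unfolding lessThan_Suc_atMost by (simp add: algebra_simps sum_subtractf)
  also have "(\<Sum>j<Suc n. g j) = (\<Sum>k<n. g (Suc k))"
    by (subst sum.lessThan_Suc_shift) (simp add: g_def)
  also have "(\<Sum>j<Suc n. g (0 + j) * d j) = down_sum g Q 0"
    using size pq by (simp add: down_sum_descents d_def)
  also have "down_sum g Q 0 = (\<Sum>k<n. g (Suc (k + right_sizes q ! k)))"
    using size pq by (simp add: down_sum_word)
  also have "(\<Sum>k<n. g (Suc k)) - (\<Sum>k<n. g (Suc (k + right_sizes q ! k))) = rotation_distance p q"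
    unfolding rotation_distance_def size sum_subtractf[symmetric]
  proof (rule sum.cong[OF refl])
    fix k assume "k \<in> {..<n}"
    then show "g (Suc k) - g (Suc (k + right_sizes q ! k)) =
      left_depths p 0 ! k - left_depths p 0 ! (k + right_sizes q ! k)"
      using g[of k] g[of "k + right_sizes q ! k"] right_sizes_bound[of k q] size by simp
  qed
  finally show ?thesis using tamari_distance_word[of n p q] le I pq by simp
qed

end
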